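(* Let $\lambda_1>\lambda_2>0$, $\alpha,\beta>0$, $\eta>0$, $H=\mathrm{diag}(\lambda_1,\lambda_2)$, and $$\Delta_1=(\alpha,\beta),\quad\Delta_2=(-\alpha,\beta),\quad\Delta_3=(\alpha,-\beta),\quad\Delta_4=(-\alpha,-\beta),\qquad g_t=-H\Delta_t\in\mathbb{R}^2.$$ For a balanced partition of $\{1,2,3,4\}$ into two-element groups $G_1,G_2$, let $\bar g_k=\frac12\sum_{t\in G_k}g_t$ and define its merging gain $$\mathcal{G}_{\mathrm{var}}=\frac{\eta^2}{8}(\bar g_1-\bar g_2)^\top H(\bar g_1-\bar g_2).$$ Denote by $\mathcal{G}_{\mathrm{var}}^{(1)},\mathcal{G}_{\mathrm{var}}^{(2)},\mathcal{G}_{\mathrm{var}}^{(3)}$ the gains of the three balanced partitions $\mathcal{P}_1=\{1,3\}\,|\,\{2,4\}$ (split along coordinate 1), $\mathcal{P}_2=\{1,2\}\,|\,\{3,4\}$ (split along coordinate 2), $\mathcal{P}_3=\{1,4\}\,|\,\{2,3\}$. If $$\lambda_1^2\alpha^2>\lambda_2^2\beta^2,$$ then $\mathcal{P}_1$ attains the maximum gain among all balanced partitions: $$\mathcal{G}_{\mathrm{var}}^{(1)}=\tfrac{\eta^2}{2}\lambda_1^3\alpha^2\ \ge\ \tfrac{\eta^2}{2}\lambda_2^3\beta^2=\mathcal{G}_{\mathrm{var}}^{(2)}\ >\ 0=\mathcal{G}_{\mathrm{var}}^{(3)}.$$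
   Context: Interpretation: four datasets have quadratic losses $L_t(\theta)=\frac12(\theta-\theta_t^\star)^\top H(\theta-\theta_t^\star)$ with centered optima $\Delta_t=\theta_t^\star-\frac14\sum_s\theta_s^\star$, and $g_t$ is the gradient of $L_t$ at the mean of the optima. The hypothesis $\lambda_1^2\alpha^2>\lambda_2^2\beta^2$ says exactly that coordinate 1 is the top principal direction of the gradients $g_1,\dots,g_4$, i.e. that $\mathcal{P}_1$ is the PCA-aligned split. *)

theory Defs
  imports "HOL-Analysis.Analysis"
begin

(* A partition into two groups is given by its groups in some order;
   var_gain below is symmetric in the two groups, so the order is immaterial. *)
definition balanced_partition :: "nat set \<Rightarrow> nat set \<Rightarrow> bool" where
  "balanced_partition G1 G2 \<longleftrightarrow>
     G1 \<union> G2 = {1..4} \<and> G1 \<inter> G2 = {} \<and> card G1 = 2 \<and> card G2 = 2"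

definition group_mean :: "(nat \<Rightarrow> real ^ 2) \<Rightarrow> nat set \<Rightarrow> real ^ 2" where
  "group_mean g G = (1 / 2) *\<^sub>R (\<Sum>t\<in>G. g t)"

definition var_gain ::
  "real \<Rightarrow> real ^ 2 ^ 2 \<Rightarrow> (nat \<Rightarrow> real ^ 2) \<Rightarrow> nat set \<Rightarrow> nat set \<Rightarrow> real" where
  "var_gain \<eta> H g G1 G2 =
     \<eta>\<^sup>2 / 8 * ((group_mean g G1 - group_mean g G2) \<bullet> (H *v (group_mean g G1 - group_mean g G2)))"

end

theory Submission
  imports Defs
begin

text \<open>Since \<open>H\<close> is diagonal, the gain is \<open>\<eta>\<^sup>2 / 8\<close> times
  a sum of squared coordinates of the difference of group means, weighted by \<open>lam1\<close> and
  \<open>lam2\<close> (\<open>var_gain_diag\<close>). The four gradients are the corners of a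
  rectangle centred at 0, with half-sides \<open>lam1 * \<alpha>\<close> and
  \<open>lam2 * \<beta>\<close>. Grouping by a side leaves a mean difference along one axis, of
  length twice the half-side; grouping by diagonals makes both means 0. This yields the cubic gains:
  two factors of the eigenvalue come from the gradients and one from the form \<open>H\<close>. The
  hypothesis on squares, multiplied by \<open>lam2 < lam1\<close>, orders the two nonzero gains.
  \<open>balanced_partition_iff\<close> reduces maximality to these cases.\<close>

text \<open>The second group is the complement of the first, so the pair is determined by a choice
  of two elements out of four. Pairs are ordered here, hence six cases for three partitions.\<close>

lemma balanced_partition_iff:
  "balanced_partition G1 G2 \<longleftrightarrow>
     (G1, G2) \<in> {({1, 3}, {2, 4}), ({2, 4}, {1, 3}), ({1, 2}, {3, 4}),
                ({3, 4}, {1, 2}), ({1, 4}, {2, 3}), ({2, 3}, {1, 4})}"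
    (is "_ \<longleftrightarrow> _ \<in> ?P")
proof -
  have univ: "{1..4::nat} = {1, 2, 3, 4}"
    by auto
  show ?thesis
  proof
    assume bp: "balanced_partition G1 G2"
    then obtain x y where G1: "G1 = {x, y}" and "x \<noteq> y"
      by (auto simp: balanced_partition_def card_2_iff)
    moreover have "G2 = {1, 2, 3, 4} - {x, y}"
      using bp unfolding balanced_partition_def univ G1 by blast
    moreover have "x \<in> {1, 2, 3, 4}" "y \<in> {1, 2, 3, 4}"
      using bp unfolding balanced_partition_def univ G1 by blast+
    ultimately show "(G1, G2) \<in> ?P"
      by (elim insertE emptyE) (simp_all add: insert_Diff_if doubleton_eq_iff)
  next
    assume "(G1, G2) \<in> ?P"
    then show "balanced_partition G1 G2"
      unfolding balanced_partition_def univ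
      by (elim insertE emptyE) auto
  qed
qed

text \<open>Swapping the groups negates the mean difference, and a quadratic form is even;
  \<open>H\<close> is arbitrary here.\<close>

lemma var_gain_commute: "var_gain \<eta> H g G1 G2 = var_gain \<eta> H g G2 G1"
  by (simp add: var_gain_def matrix_vector_mult_diff_distrib inner_diff_left inner_diff_right)

lemma var_gain_diag:
  assumes "H = vector [vector [a, 0], vector [0, b]]"
  shows "var_gain \<eta> H g G1 G2 = \<eta>\<^sup>2 / 8 *
    (a * ((group_mean g G1 - group_mean g G2) $ 1)\<^sup>2
     + b * ((group_mean g G1 - group_mean g G2) $ 2)\<^sup>2)"
  by (simp add: assms var_gain_def inner_vec_def sum_2 matrix_vector_mult_def
      power2_eq_square algebra_simps)

theorem propositionF6:
  fixes lam1 lam2 \<alpha> \<beta> \<eta> :: real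
    and H :: "real ^ 2 ^ 2"
    and \<Delta> g :: "nat \<Rightarrow> real ^ 2"
  assumes "lam1 > lam2" and "lam2 > 0" and "\<alpha> > 0" and "\<beta> > 0" and "\<eta> > 0"
    and "H = vector [vector [lam1, 0], vector [0, lam2]]"
    and "\<Delta> 1 = vector [\<alpha>, \<beta>]" and "\<Delta> 2 = vector [- \<alpha>, \<beta>]"
    and "\<Delta> 3 = vector [\<alpha>, - \<beta>]" and "\<Delta> 4 = vector [- \<alpha>, - \<beta>]"
    and "\<And>t. t \<in> {1..4} \<Longrightarrow> g t = - (H *v \<Delta> t)"
    and "lam1\<^sup>2 * \<alpha>\<^sup>2 > lam2\<^sup>2 * \<beta>\<^sup>2"
  shows "{{G1, G2} | G1 G2. balanced_partition G1 G2}
           = {{{1, 3}, {2, 4}}, {{1, 2}, {3, 4}}, {{1, 4}, {2, 3}}}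
    \<and> (\<forall>G1 G2. balanced_partition G1 G2 \<longrightarrow>
           var_gain \<eta> H g G1 G2 \<le> var_gain \<eta> H g {1, 3} {2, 4})
    \<and> var_gain \<eta> H g {1, 3} {2, 4} = \<eta>\<^sup>2 / 2 * lam1 ^ 3 * \<alpha>\<^sup>2
    \<and> \<eta>\<^sup>2 / 2 * lam1 ^ 3 * \<alpha>\<^sup>2 \<ge> \<eta>\<^sup>2 / 2 * lam2 ^ 3 * \<beta>\<^sup>2
    \<and> \<eta>\<^sup>2 / 2 * lam2 ^ 3 * \<beta>\<^sup>2 = var_gain \<eta> H g {1, 2} {3, 4}
    \<and> var_gain \<eta> H g {1, 2} {3, 4} > 0
    \<and> 0 = var_gain \<eta> H g {1, 4} {2, 3}"
proof -
  have g: "g 1 = vector [- (lam1 * \<alpha>), - (lam2 * \<beta>)]" "g 2 = vector [lam1 * \<alpha>, - (lam2 * \<beta>)]"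
    "g 3 = vector [- (lam1 * \<alpha>), lam2 * \<beta>]" "g 4 = vector [lam1 * \<alpha>, lam2 * \<beta>]"
    using assms(6-11)
    by (simp_all add: vec_eq_iff forall_2 matrix_vector_mult_def sum_2)
  note gain = var_gain_diag[OF assms(6)]
  \<comment> \<open>The mean differences in the three cases are
    \<open>(-2 * lam1 * \<alpha>, 0)\<close>, \<open>(0, -2 * lam2 * \<beta>)\<close> and
    \<open>(0, 0)\<close>. Without \<open>One_nat_def\<close> the index in \<open>g 1\<close> stays
    in the form that the equations \<open>g\<close> rewrite.\<close>
  have gain1: "var_gain \<eta> H g {1, 3} {2, 4} = \<eta>\<^sup>2 / 2 * lam1 ^ 3 * \<alpha>\<^sup>2"
    by (simp add: gain group_mean_def g power2_eq_square power3_eq_cube del: One_nat_def)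
  have gain2: "var_gain \<eta> H g {1, 2} {3, 4} = \<eta>\<^sup>2 / 2 * lam2 ^ 3 * \<beta>\<^sup>2"
    by (simp add: gain group_mean_def g power2_eq_square power3_eq_cube del: One_nat_def)
  have gain3: "var_gain \<eta> H g {1, 4} {2, 3} = 0"
    by (simp add: gain group_mean_def g del: One_nat_def)
  \<comment> \<open>The cubes are split as eigenvalue times squared gradient coordinate, so that
    both strict hypotheses multiply as inequalities between nonnegative factors.\<close>
  have "lam2 * (lam2\<^sup>2 * \<beta>\<^sup>2) \<le> lam1 * (lam1\<^sup>2 * \<alpha>\<^sup>2)"
    using assms(1,2,12) by (intro mult_mono[OF less_imp_le less_imp_le]) simp_all
  then have "\<eta>\<^sup>2 / 2 * (lam2 * (lam2\<^sup>2 * \<beta>\<^sup>2)) \<le> \<eta>\<^sup>2 / 2 * (lam1 * (lam1\<^sup>2 * \<alpha>\<^sup>2))"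
    by (intro mult_left_mono) auto
  then have ge: "\<eta>\<^sup>2 / 2 * lam2 ^ 3 * \<beta>\<^sup>2 \<le> \<eta>\<^sup>2 / 2 * lam1 ^ 3 * \<alpha>\<^sup>2"
    by (simp add: power2_eq_square power3_eq_cube mult.assoc)
  have pos: "\<eta>\<^sup>2 / 2 * lam2 ^ 3 * \<beta>\<^sup>2 > 0"
    using assms by simp
  have "var_gain \<eta> H g G1 G2 \<le> var_gain \<eta> H g {1, 3} {2, 4}" if "balanced_partition G1 G2" for G1 G2
  proof -
    have swapped: "var_gain \<eta> H g {2, 4} {1, 3} = var_gain \<eta> H g {1, 3} {2, 4}"
      "var_gain \<eta> H g {3, 4} {1, 2} = var_gain \<eta> H g {1, 2} {3, 4}"
      "var_gain \<eta> H g {2, 3} {1, 4} = var_gain \<eta> H g {1, 4} {2, 3}"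
      by (rule var_gain_commute)+
    from that have "(G1, G2) \<in> {({1, 3}, {2, 4}), ({2, 4}, {1, 3}), ({1, 2}, {3, 4}),
        ({3, 4}, {1, 2}), ({1, 4}, {2, 3}), ({2, 3}, {1, 4})}"
      by (simp only: balanced_partition_iff)
    \<comment> \<open>Only three values can occur; \<open>ge\<close> bounds the second by the first,
      and \<open>pos\<close> together with \<open>ge\<close> bounds 0.\<close>
    then have "var_gain \<eta> H g G1 G2 \<in> {\<eta>\<^sup>2 / 2 * lam1 ^ 3 * \<alpha>\<^sup>2, \<eta>\<^sup>2 / 2 * lam2 ^ 3 * \<beta>\<^sup>2, 0}"
      by (elim insertE emptyE Pair_inject) (simp_all only: swapped gain1 gain2 gain3 insert_iff simp_thms)
    then show ?thesis
      unfolding gain1 using ge pos by (elim insertE emptyE) linarith+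
  qed
  moreover have "{{G1, G2} | G1 G2. balanced_partition G1 G2}
      = {{{1, 3}, {2, 4}}, {{1, 2}, {3, 4}}, {{1, 4}, {2, 3}}}"
    (is "?L = ?R")
  proof
    show "?L \<subseteq> ?R"
    proof
      fix P
      assume "P \<in> ?L"
      then obtain G1 G2 where "P = {G1, G2}" and "balanced_partition G1 G2"
        by blast
      \<comment> \<open>Passing to unordered pairs identifies the six cases two by two.\<close>
      then show "P \<in> ?R"
        unfolding balanced_partition_iff
        by (elim insertE emptyE Pair_inject) (simp_all only: insert_iff doubleton_eq_iff simp_thms)
    qed
    have "balanced_partition {1, 3} {2, 4}" "balanced_partition {1, 2} {3, 4}"
      "balanced_partition {1, 4} {2, 3}"
      by (simp_all add: balanced_partition_iff)
    then show "?R \<subseteq> ?L"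
      by blast
  qed
  ultimately show ?thesis
    unfolding gain1 gain2 gain3 using ge pos by blast
qed

end
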